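(* Let the outputs $Y_t$ be identically distributed random variables with finite $p$-th moments $\mathbb{E}(|Y_t|^p)<\infty$ for some $p\ge 1$. If the outputs are out of $p$-reasonable order with respect to the inputs $X_t$, that is, $$B_{n,p}:=\frac{1}{n^{1/p}}\sum_{t=2}^n|Y_{t,n}-Y_{t-1,n}|\to_{\mathbb{P}}\infty\quad\text{when } n\to\infty,$$ then $$I_n:=\frac{\sum_{i=2}^n(Y_{i,n}-Y_{i-1,n})_+}{\sum_{i=2}^n|Y_{i,n}-Y_{i-1,n}|}\to_{\mathbb{P}}\frac12\quad\text{when } n\to\infty.$$
   Context: The inputs $(X_t)_{t\in\mathbb{Z}}$ are a stationary sequence of real-valued random variables whose marginal cdf's are all the same and continuous; the inputs are assumed (almost surely) pairwise distinct, so the order statistics of $X_1,\dots,X_n$ satisfy $X_{1:n}<\cdots<X_{n:n}$. The outputs are real-valued random variables $Y_t=h(X_t,\boldsymbol{\varepsilon}_t)$, where $h:\mathbb{R}^{1+d}\to\mathbb{R}$ is the transfer function and $\boldsymbol{\varepsilon}_t$ are $\mathbb{R}^d$-valued random variables (anomalies). The concomitants of $Y_1,\dots,Y_n$ with respect to the inputs are $Y_{t,n}=\sum_{s=1}^n Y_s\mathbf{1}\{X_s=X_{t:n}\}$, $t=1,\dots,n$. $z_+=\max(z,0)$; $\to_{\mathbb{P}}$ denotes convergence in probability, and $B_{n,p}\to_{\mathbb{P}}\infty$ means $\mathbb{P}(B_{n,p}\le\lambda)\to 0$ for every $\lambda<\infty$. On the event that the denominator of $I_n$ is zero, $I_n$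 may be given any fixed value. *)

theory Defs
  imports "HOL-Probability.Probability"
begin

definition stationary :: "'a measure \<Rightarrow> (int \<Rightarrow> 'a \<Rightarrow> real) \<Rightarrow> bool" where
  "stationary M X \<longleftrightarrow>
     (\<forall>J k. finite J \<longrightarrow>
        distr M (\<Pi>\<^sub>M t\<in>J. borel) (\<lambda>\<omega>. \<lambda>t\<in>J. X (t + k) \<omega>) =
        distr M (\<Pi>\<^sub>M t\<in>J. borel) (\<lambda>\<omega>. \<lambda>t\<in>J. X t \<omega>))"

definition identically_distributed :: "'a measure \<Rightarrow> ('i \<Rightarrow> 'a \<Rightarrow> real) \<Rightarrow> bool" where
  "identically_distributed M Y \<longleftrightarrow> (\<forall>s t. distr M borel (Y s) = distr M borel (Y t))"

(* Measurability is part of the notion: "measure" is 0 on non-measurable sets, which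
   would otherwise make non-measurable sequences converge to everything. *)
definition converges_in_prob :: "'a measure \<Rightarrow> (nat \<Rightarrow> 'a \<Rightarrow> real) \<Rightarrow> real \<Rightarrow> bool" where
  "converges_in_prob M Z c \<longleftrightarrow>
     (\<forall>n. Z n \<in> borel_measurable M) \<and>
     (\<forall>e>0. (\<lambda>n. measure M {\<omega> \<in> space M. \<bar>Z n \<omega> - c\<bar> > e}) \<longlonglongrightarrow> 0)"

(* No measurability clause here: the notion is only used as a hypothesis, about a
   sequence that is measurable as soon as the inputs and outputs are. *)
definition diverges_in_prob :: "'a measure \<Rightarrow> (nat \<Rightarrow> 'a \<Rightarrow> real) \<Rightarrow> bool" where
  "diverges_in_prob M Z \<longleftrightarrow>
     (\<forall>c. (\<lambda>n. measure M {\<omega> \<in> space M. Z n \<omega> \<le> c}) \<longlonglongrightarrow> 0)"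

(* The notions below are pathwise: x and y are realisations of the inputs and outputs.
   Sample indices run over 1..n; the value at indices outside this range is irrelevant. *)

definition order_stat :: "(int \<Rightarrow> real) \<Rightarrow> nat \<Rightarrow> nat \<Rightarrow> real" where
  "order_stat x n t = sort (map (\<lambda>s. x (int s)) [1..<n+1]) ! (t - 1)"

definition concomitant :: "(int \<Rightarrow> real) \<Rightarrow> (int \<Rightarrow> real) \<Rightarrow> nat \<Rightarrow> nat \<Rightarrow> real" where
  "concomitant x y n t = (\<Sum>s=1..n. y (int s) * of_bool (x (int s) = order_stat x n t))"

definition B_stat :: "real \<Rightarrow> (int \<Rightarrow> real) \<Rightarrow> (int \<Rightarrow> real) \<Rightarrow> nat \<Rightarrow> real" where
  "B_stat p x y n =
     1 / real n powr (1 / p) *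
     (\<Sum>t=2..n. \<bar>concomitant x y n t - concomitant x y n (t - 1)\<bar>)"

(* c is the value given to the index when its denominator vanishes *)
definition I_stat :: "real \<Rightarrow> (int \<Rightarrow> real) \<Rightarrow> (int \<Rightarrow> real) \<Rightarrow> nat \<Rightarrow> real" where
  "I_stat c x y n =
     (let num = (\<Sum>i=2..n. max (concomitant x y n i - concomitant x y n (i - 1)) 0);
          den = (\<Sum>i=2..n. \<bar>concomitant x y n i - concomitant x y n (i - 1)\<bar>)
      in if den = 0 then c else num / den)"

definition out_of_reasonable_order ::
    "'a measure \<Rightarrow> real \<Rightarrow> (int \<Rightarrow> 'a \<Rightarrow> real) \<Rightarrow> (int \<Rightarrow> 'a \<Rightarrow> real) \<Rightarrow> bool" where
  "out_of_reasonable_order M p X Y \<longleftrightarrow>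
     diverges_in_prob M (\<lambda>n \<omega>. B_stat p (\<lambda>t. X t \<omega>) (\<lambda>t. Y t \<omega>) n)"

end

theory Submission
  imports Defs
begin

text \<open>
  Since \<open>z\<^sub>+ = (z + \<bar>z\<bar>) / 2\<close>, the numerator of the index telescopes up to half the denominator:
  \<open>I\<^sub>n - 1/2 = (Y\<^sub>n\<^sub>,\<^sub>n - Y\<^sub>1\<^sub>,\<^sub>n) / (2 D\<^sub>n)\<close> with \<open>D\<^sub>n = n\<^sup>1\<^sup>/\<^sup>p B\<^sub>n\<^sub>,\<^sub>p\<close>. Inputs being distinct, both concomitants are
  outputs, and by Markov's inequality and a union bound the maximum of \<open>\<bar>Y\<^sub>1\<bar>, \<dots>, \<bar>Y\<^sub>n\<bar>\<close> exceeds
  \<open>(n T)\<^sup>1\<^sup>/\<^sup>p\<close> with probability at most \<open>E \<bar>Y\<bar>\<^sup>p / T\<close>, uniformly in \<open>n\<close>. So the ratio is small once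
  \<open>B\<^sub>n\<^sub>,\<^sub>p\<close> is large.
\<close>

text \<open>In a sorted list the entries up to \<open>a\<close> form an initial segment, so position
  \<open>k\<close> lies in it exactly when its length exceeds \<open>k\<close>.\<close>

lemma sorted_nth_le_iff:
  fixes xs :: "'a :: linorder list"
  assumes "sorted xs" "k < length xs"
  shows "xs ! k \<le> a \<longleftrightarrow> k < length (filter (\<lambda>x. x \<le> a) xs)"
  using assms
proof (induction xs arbitrary: k)
  case (Cons x xs)
  show ?case
  proof (cases "x \<le> a")
    case True
    with Cons show ?thesis by (cases k) auto
  next
    case False
    then have "filter (\<lambda>x. x \<le> a) (x # xs) = []"
      using Cons.prems(1) by (auto simp: filter_empty_conv)
    moreover have "x \<le> (x # xs) ! k"
      using Cons.prems by (cases k) auto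
    ultimately show ?thesis using False by auto
  qed
qed simp

text \<open>Sorting is traded for counting: the right-hand side is a finite sum of indicators of the
  inputs, so the sublevel sets of an order statistic become visibly measurable.\<close>

lemma order_stat_le_iff:
  assumes "1 \<le> t" "t \<le> n"
  shows "order_stat x n t \<le> a \<longleftrightarrow> real t \<le> (\<Sum>s=1..n. indicator {..a} (x (int s)))"
proof -
  let ?l = "map (\<lambda>s. x (int s)) [1..<n+1]"
  have "order_stat x n t \<le> a \<longleftrightarrow> t - 1 < length (filter (\<lambda>v. v \<le> a) (sort ?l))"
    unfolding order_stat_def using assms by (subst sorted_nth_le_iff) auto
  also have "length (filter (\<lambda>v. v \<le> a) (sort ?l)) = length (filter (\<lambda>v. v \<le> a) ?l)"
    by (simp only: filter_sort length_sort)
  also have "\<dots> = card {s \<in> {1..n}. x (int s) \<le> a}"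
  proof -
    have "length (filter (\<lambda>v. v \<le> a) ?l) = length (filter (\<lambda>s. x (int s) \<le> a) [1..<n+1])"
      by (simp only: filter_map length_map o_def)
    also have "\<dots> = card (set (filter (\<lambda>s. x (int s) \<le> a) [1..<n+1]))"
      by (rule distinct_card[symmetric]) simp
    also have "set (filter (\<lambda>s. x (int s) \<le> a) [1..<n+1]) = {s \<in> {1..n}. x (int s) \<le> a}"
      by auto
    finally show ?thesis .
  qed
  \<comment> \<open>List positions start at 0 and order statistics at 1; \<open>1 \<le> t\<close>
    keeps the natural subtraction from truncating.\<close>
  also have "t - 1 < card {s \<in> {1..n}. x (int s) \<le> a} \<longleftrightarrow>
      real t \<le> real (card {s \<in> {1..n}. x (int s) \<le> a})"
    using assms by (simp add: of_nat_le_iff) linarith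
  also have "real (card {s \<in> {1..n}. x (int s) \<le> a}) = (\<Sum>s=1..n. indicator {..a} (x (int s)))"
    by (simp add: indicator_def sum.If_cases Int_def)
  finally show ?thesis .
qed

lemma order_stat_measurable:
  assumes [measurable]: "\<And>t. X t \<in> borel_measurable M" and "1 \<le> t" "t \<le> n"
  shows "(\<lambda>\<omega>. order_stat (\<lambda>s. X s \<omega>) n t) \<in> borel_measurable M"
  unfolding borel_measurable_iff_le
  by (simp only: order_stat_le_iff[OF assms(2,3)]) measurable

lemma concomitant_measurable:
  assumes [measurable]: "\<And>t. X t \<in> borel_measurable M" "\<And>t. Y t \<in> borel_measurable M"
    and "1 \<le> t" "t \<le> n"
  shows "(\<lambda>\<omega>. concomitant (\<lambda>s. X s \<omega>) (\<lambda>s. Y s \<omega>) n t) \<in> borel_measurable M"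
proof -
  note [measurable] = order_stat_measurable[OF assms(1,3,4)]
  show ?thesis unfolding concomitant_def of_bool_def by measurable
qed

text \<open>The range \<open>{2..n}\<close> keeps both \<open>t\<close> and \<open>t - 1\<close>
  inside the sample and is the summation range of both statistics.\<close>

lemma concomitant_diff_measurable:
  assumes "\<And>t. X t \<in> borel_measurable M" "\<And>t. Y t \<in> borel_measurable M" "t \<in> {2..n}"
  shows "(\<lambda>\<omega>. concomitant (\<lambda>s. X s \<omega>) (\<lambda>s. Y s \<omega>) n t
            - concomitant (\<lambda>s. X s \<omega>) (\<lambda>s. Y s \<omega>) n (t - 1)) \<in> borel_measurable M"
  using assms by (intro borel_measurable_diff concomitant_measurable) auto

lemma B_stat_measurable:
  assumes "\<And>t. X t \<in> borel_measurable M" "\<And>t. Y t \<in> borel_measurable M"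
  shows "(\<lambda>\<omega>. B_stat p (\<lambda>s. X s \<omega>) (\<lambda>s. Y s \<omega>) n) \<in> borel_measurable M"
  unfolding B_stat_def
  by (intro borel_measurable_times borel_measurable_const borel_measurable_sum
      borel_measurable_abs concomitant_diff_measurable assms)

lemma I_stat_measurable:
  assumes "\<And>t. X t \<in> borel_measurable M" "\<And>t. Y t \<in> borel_measurable M"
  shows "(\<lambda>\<omega>. I_stat c (\<lambda>s. X s \<omega>) (\<lambda>s. Y s \<omega>) n) \<in> borel_measurable M"
proof -
  let ?d = "\<lambda>i \<omega>. concomitant (\<lambda>s. X s \<omega>) (\<lambda>s. Y s \<omega>) n i
                 - concomitant (\<lambda>s. X s \<omega>) (\<lambda>s. Y s \<omega>) n (i - 1)"
  \<comment> \<open>Explicit rules are applied here because measurability of a summand relies on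
    \<open>i\<close> lying in \<open>{2..n}\<close>.\<close>
  have [measurable]: "(\<lambda>\<omega>. \<Sum>i=2..n. max (?d i \<omega>) 0) \<in> borel_measurable M"
      "(\<lambda>\<omega>. \<Sum>i=2..n. \<bar>?d i \<omega>\<bar>) \<in> borel_measurable M"
    by (intro borel_measurable_sum borel_measurable_max borel_measurable_abs
        borel_measurable_const concomitant_diff_measurable assms; assumption)+
  show ?thesis unfolding I_stat_def Let_def by measurable
qed

text \<open>The order statistic is one of the sampled inputs, and by injectivity only its own index
  contributes to the defining sum.\<close>

lemma concomitant_eq_output:
  assumes inj: "inj x" and "1 \<le> t" "t \<le> n"
  obtains s where "s \<in> {1..n}" "concomitant x y n t = y (int s)"
proof -
  have "order_stat x n t \<in> set (sort (map (\<lambda>s. x (int s)) [1..<n+1]))"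
    unfolding order_stat_def using assms by (intro nth_mem) auto
  then have "order_stat x n t \<in> (\<lambda>s. x (int s)) ` {1..n}"
    unfolding set_sort set_map set_upt atLeastLessThanSuc_atLeastAtMost Suc_eq_plus1[symmetric] .
  then obtain s where s: "s \<in> {1..n}" "order_stat x n t = x (int s)"
    by auto
  have "concomitant x y n t = (\<Sum>r\<in>{1..n}. if r = s then y (int r) else 0)"
    unfolding concomitant_def s(2) using inj by (intro sum.cong) (auto simp: inj_eq)
  also have "\<dots> = y (int s)" using s by simp
  finally show thesis using s that by blast
qed

text \<open>The positive part is the mean of a number and its absolute value, and the signed
  increments telescope. At \<open>n = 0\<close> the sums are empty while \<open>u 0 - u 1\<close>
  may be nonzero, hence \<open>1 \<le> n\<close>.\<close>

lemma sum_max_0_telescope: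
  fixes u :: "nat \<Rightarrow> real"
  assumes "1 \<le> n"
  shows "(\<Sum>i=2..n. max (u i - u (i - 1)) 0) = (u n - u 1 + (\<Sum>i=2..n. \<bar>u i - u (i - 1)\<bar>)) / 2"
  using assms
proof (induction n rule: dec_induct)
  case (step k)
  then have "{2..Suc k} = insert (Suc k) {2..k}" by auto
  with step show ?case by (simp add: max_def abs_if field_simps)
qed simp

text \<open>The pathwise core: a deviation beyond \<open>e\<close> forces the denominator to be
  small relative to the outer concomitants. The resulting bound \<open>K / e\<close> is free of
  \<open>n\<close>, as divergence in probability requires.\<close>

lemma B_stat_le_of_I_stat_deviates:
  assumes "inj x" "1 \<le> n" "0 < e" "0 \<le> K"
    and bound: "\<And>s. s \<in> {1..n} \<Longrightarrow> \<bar>y (int s)\<bar> \<le> K * real n powr (1 / p)"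
    and dev: "\<bar>I_stat c x y n - 1 / 2\<bar> > e"
  shows "B_stat p x y n \<le> K / e"
proof -
  let ?u = "concomitant x y n"
  define D where "D = (\<Sum>i=2..n. \<bar>?u i - ?u (i - 1)\<bar>)"
  define r where "r = real n powr (1 / p)"
  have r: "r > 0" using assms by (simp add: r_def)
  have B: "B_stat p x y n = D / r"
    by (simp add: B_stat_def D_def r_def)
  have "D \<ge> 0" by (simp add: D_def sum_nonneg)
  show ?thesis
  proof (cases "D = 0")
    \<comment> \<open>Here the index is the arbitrary value \<open>c\<close>, so \<open>dev\<close>
      carries no information; but \<open>B_stat\<close> is then 0.\<close>
    case True
    then show ?thesis using B assms by simp
  next
    case False
    with \<open>D \<ge> 0\<close> have "D > 0" by simp
    have "I_stat c x y n = ((?u n - ?u 1 + D) / 2) / D"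
      using False unfolding I_stat_def Let_def D_def sum_max_0_telescope[OF \<open>1 \<le> n\<close>] by simp
    then have I: "I_stat c x y n - 1 / 2 = (?u n - ?u 1) / (2 * D)"
      using False by (simp add: field_simps)
    have u: "\<bar>?u t\<bar> \<le> K * r" if "1 \<le> t" "t \<le> n" for t
      using concomitant_eq_output[OF \<open>inj x\<close> that, of y] bound unfolding r_def by metis
    have "e * (2 * D) < \<bar>?u n - ?u 1\<bar>"
      using dev \<open>D > 0\<close> unfolding I by (simp add: abs_divide pos_less_divide_eq)
    also have "\<dots> \<le> 2 * (K * r)"
      using u[of n] u[of 1] \<open>1 \<le> n\<close> by simp
    finally have "e * D \<le> K * r" by simp
    then show ?thesis unfolding B using r \<open>0 < e\<close> by (simp add: field_simps)
  qed
qed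

lemma identically_distributed_expectation:
  fixes g :: "real \<Rightarrow> real"
  assumes "identically_distributed M Y" and [measurable]: "\<And>t. Y t \<in> borel_measurable M"
    and [measurable]: "g \<in> borel_measurable borel"
  shows "(\<integral>\<omega>. g (Y s \<omega>) \<partial>M) = (\<integral>\<omega>. g (Y t \<omega>) \<partial>M)"
proof -
  have "(\<integral>\<omega>. g (Y r \<omega>) \<partial>M) = (\<integral>v. g v \<partial>distr M borel (Y r))" for r
    by (rule integral_distr[symmetric]) auto
  then show ?thesis using assms(1) unfolding identically_distributed_def by metis
qed

text \<open>Markov's inequality at level \<open>T * real n\<close> gives each of the
  \<open>n\<close> events probability at most the moment over \<open>T * real n\<close>, so
  \<open>n\<close> cancels in the union bound. The threshold is written as a product to fit the
  pathwise bound with \<open>K = T powr (1 / p)\<close>.\<close>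

lemma (in prob_space) prob_exists_gt_root_le:
  assumes "identically_distributed M Y" and [measurable]: "\<And>t. Y t \<in> borel_measurable M"
    and int: "\<And>t. integrable M (\<lambda>\<omega>. \<bar>Y t \<omega>\<bar> powr p)"
    and "p > 0" "T > 0" "1 \<le> n"
  shows "prob {\<omega> \<in> space M. \<exists>s\<in>{1..n}. T powr (1 / p) * real n powr (1 / p) < \<bar>Y (int s) \<omega>\<bar>}
           \<le> expectation (\<lambda>\<omega>. \<bar>Y 0 \<omega>\<bar> powr p) / T"
proof -
  let ?m = "expectation (\<lambda>\<omega>. \<bar>Y 0 \<omega>\<bar> powr p)"
  let ?A = "\<lambda>s. {\<omega> \<in> space M. T * real n \<le> \<bar>Y (int s) \<omega>\<bar> powr p}"
  have "{\<omega> \<in> space M. \<exists>s\<in>{1..n}. T powr (1 / p) * real n powr (1 / p) < \<bar>Y (int s) \<omega>\<bar>}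
      \<subseteq> (\<Union>s\<in>{1..n}. ?A s)"
  proof safe
    fix \<omega> s
    assume "s \<in> {1..n}" "\<omega> \<in> space M"
      and "T powr (1 / p) * real n powr (1 / p) < \<bar>Y (int s) \<omega>\<bar>"
    then have "(T * real n) powr (1 / p) \<le> \<bar>Y (int s) \<omega>\<bar>"
      using assms by (simp add: powr_mult)
    then have "((T * real n) powr (1 / p)) powr p \<le> \<bar>Y (int s) \<omega>\<bar> powr p"
      using assms by (intro powr_mono2) auto
    then have "T * real n \<le> \<bar>Y (int s) \<omega>\<bar> powr p"
      using assms by (simp add: powr_powr)
    with \<open>s \<in> {1..n}\<close> \<open>\<omega> \<in> space M\<close> show "\<omega> \<in> (\<Union>s\<in>{1..n}. ?A s)" by blast
  qed
  then have "prob {\<omega> \<in> space M. \<exists>s\<in>{1..n}. T powr (1 / p) * real n powr (1 / p) < \<bar>Y (int s) \<omega>\<bar>}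
      \<le> prob (\<Union>s\<in>{1..n}. ?A s)"
    by (intro finite_measure_mono) auto
  also have "\<dots> \<le> (\<Sum>s=1..n. prob (?A s))"
    by (intro finite_measure_subadditive_finite) auto
  also have "\<dots> \<le> (\<Sum>s=1..n. ?m / (T * real n))"
  proof (rule sum_mono)
    fix s :: nat
    have "prob (?A s) \<le> expectation (\<lambda>\<omega>. \<bar>Y (int s) \<omega>\<bar> powr p) / (T * real n)"
      using assms by (intro integral_Markov_inequality_measure[where A = "{}"]) auto
    also have "expectation (\<lambda>\<omega>. \<bar>Y (int s) \<omega>\<bar> powr p) = ?m"
      by (rule identically_distributed_expectation[where g = "\<lambda>v. \<bar>v\<bar> powr p", OF assms(1,2)]) simp
    finally show "prob (?A s) \<le> ?m / (T * real n)" .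
  qed
  also have "\<dots> = ?m / T" using assms by simp
  finally show ?thesis .
qed

theorem theorem8p1:
  fixes M :: "'a measure"
    and X Y :: "int \<Rightarrow> 'a \<Rightarrow> real"
    and \<epsilon> :: "int \<Rightarrow> 'a \<Rightarrow> real ^ 'd"
    and h :: "real \<times> (real ^ 'd) \<Rightarrow> real"
    and F :: "real \<Rightarrow> real"
    and p c :: real
  assumes "prob_space M"
    and "\<And>t. X t \<in> borel_measurable M"
    and "stationary M X"
    and "\<And>t. cdf (distr M borel (X t)) = F"
    and "continuous_on UNIV F"
    and "AE \<omega> in M. inj (\<lambda>t. X t \<omega>)"
    and "\<And>t. \<epsilon> t \<in> borel_measurable M"
    and "\<And>t \<omega>. \<omega> \<in> space M \<Longrightarrow> Y t \<omega> = h (X t \<omega>, \<epsilon> t \<omega>)"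
    and "\<And>t. Y t \<in> borel_measurable M"
    and "identically_distributed M Y"
    and "p \<ge> 1"
    and "\<And>t. integrable M (\<lambda>\<omega>. \<bar>Y t \<omega>\<bar> powr p)"
    and "out_of_reasonable_order M p X Y"
  shows "converges_in_prob M (\<lambda>n \<omega>. I_stat c (\<lambda>t. X t \<omega>) (\<lambda>t. Y t \<omega>) n) (1 / 2)"
proof -
  interpret prob_space M by fact
  note X[measurable] = assms(2) and Y[measurable] = assms(9)
  define m where "m = expectation (\<lambda>\<omega>. \<bar>Y 0 \<omega>\<bar> powr p)"
  have "m \<ge> 0" by (simp add: m_def)
  let ?I = "\<lambda>n \<omega>. I_stat c (\<lambda>t. X t \<omega>) (\<lambda>t. Y t \<omega>) n"
  let ?B = "\<lambda>n \<omega>. B_stat p (\<lambda>t. X t \<omega>) (\<lambda>t. Y t \<omega>) n"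
  note I[measurable] = I_stat_measurable[OF X Y] and B[measurable] = B_stat_measurable[OF X Y]
  have "(\<lambda>n. prob {\<omega> \<in> space M. \<bar>?I n \<omega> - 1 / 2\<bar> > e}) \<longlonglongrightarrow> 0" if "e > 0" for e
  proof (rule tendstoI)
    fix \<delta> :: real assume "\<delta> > 0"
    \<comment> \<open>This makes \<open>m / T\<close> fall strictly below half of
      \<open>\<delta>\<close>; the summand 1 keeps \<open>T\<close> positive when
      \<open>m = 0\<close>.\<close>
    define T where "T = (2 * m + 1) / \<delta>"
    have "T > 0" using \<open>m \<ge> 0\<close> \<open>\<delta> > 0\<close> by (simp add: T_def)
    have mT: "m / T < \<delta> / 2"
      using \<open>m \<ge> 0\<close> \<open>\<delta> > 0\<close> by (simp add: T_def field_simps)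
    define K where "K = T powr (1 / p)"
    have "(\<lambda>n. prob {\<omega> \<in> space M. ?B n \<omega> \<le> K / e}) \<longlonglongrightarrow> 0"
      using assms(13) by (simp add: out_of_reasonable_order_def diverges_in_prob_def)
    then have "\<forall>\<^sub>F n in sequentially. prob {\<omega> \<in> space M. ?B n \<omega> \<le> K / e} < \<delta> / 2"
      using \<open>\<delta> > 0\<close> by (intro order_tendstoD) auto
    then show "\<forall>\<^sub>F n in sequentially. dist (prob {\<omega> \<in> space M. \<bar>?I n \<omega> - 1 / 2\<bar> > e}) 0 < \<delta>"
      using eventually_ge_at_top[of 1]
    proof eventually_elim
      case (elim n)
      let ?BB = "{\<omega> \<in> space M. ?B n \<omega> \<le> K / e}"
      let ?YY = "{\<omega> \<in> space M. \<exists>s\<in>{1..n}. K * real n powr (1 / p) < \<bar>Y (int s) \<omega>\<bar>}"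
      have "prob {\<omega> \<in> space M. \<bar>?I n \<omega> - 1 / 2\<bar> > e} \<le> prob (?BB \<union> ?YY)"
      \<comment> \<open>The inclusion holds only almost surely, where the inputs are distinct:
        outside \<open>?YY\<close> all sampled outputs are bounded, so a deviation puts the point in
        \<open>?BB\<close>.\<close>
      proof (rule finite_measure_mono_AE)
        show "AE \<omega> in M. \<omega> \<in> {\<omega> \<in> space M. \<bar>?I n \<omega> - 1 / 2\<bar> > e} \<longrightarrow> \<omega> \<in> ?BB \<union> ?YY"
          using assms(6)
        proof eventually_elim
          case (elim \<omega>)
          then show ?case
            using B_stat_le_of_I_stat_deviates[OF elim \<open>1 \<le> n\<close> \<open>e > 0\<close>, of K "\<lambda>t. Y t \<omega>" p c]
            by (force simp: K_def not_less)
        qed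
      qed auto
      also have "\<dots> \<le> prob ?BB + prob ?YY"
        by (intro measure_Un_le) auto
      also have "prob ?YY \<le> m / T"
        unfolding K_def m_def using assms(11) \<open>T > 0\<close> \<open>1 \<le> n\<close>
        by (intro prob_exists_gt_root_le assms(10,12) Y) auto
      finally have "prob {\<omega> \<in> space M. \<bar>?I n \<omega> - 1 / 2\<bar> > e} < \<delta>"
        using elim(1) mT by linarith
      then show ?case by simp
    qed
  qed
  then show ?thesis unfolding converges_in_prob_def using I by auto
qed

end
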